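(* Let $G=\mathrm{GL}_{2n}(F)$, let $J=\begin{pmatrix}0&1_n\\-1_n&0\end{pmatrix}$, let $K=\mathrm{Sp}_{2n}(F)=\{g\in \mathrm{GL}_{2n}(F): g^TJg=J\}$, and let $B\subset G$ be the Iwahori subgroup. For each double coset $\mathcal{O}\in K\backslash G/B$ there exists a unique $w\in\mathsf{SkewAPM}_{2n}$ such that $g^TJg=w$ for some $g\in\mathcal{O}$. Moreover, for each $w\in\mathsf{SkewAPM}_{2n}$, the set of matrices $g\in G$ satisfying $g^TJg=w$ is non-empty and its elements all lie in the same double coset in $K\backslash G/B$.
   Context: $n$ is a positive integer. $\mathbb{K}$ is a quadratically closed field, i.e. a field of characteristic not equal to $2$ in which every element has a square root. $F=\mathbb{K}((t))$ is the field of formal Laurent series and $A=\mathbb{K}[[t]]$ the ring of formal power series. $1_n$ is the $n\times n$ identity matrix. The Iwahori subgroup $B$ is the subgroup of $\mathrm{GL}_{2n}(A)$ consisting of the matrices that become upper triangular upon setting $t=0$. A monomial matrix is a square matrix with exactly one non-zero entry in each row and column. $\mathsf{SkewAPM}_{2n}$ is the set of all skew-symmetric $2n\times 2n$ monomial matrices over $F$ whose non-zero entries above the diagonal are integral powers $t^a$ of $t$ ($a\in\mathbb{Z}$, varying from entry to entry). *)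

theory Defs
  imports
    "HOL-Computational_Algebra.Computational_Algebra"
    "Jordan_Normal_Form.Matrix"
begin

definition quadratically_closed :: "'a::field itself \<Rightarrow> bool" where
  "quadratically_closed _ \<longleftrightarrow> CHAR('a) \<noteq> 2 \<and> (\<forall>x::'a. \<exists>y. y ^ 2 = x)"

definition GL :: "nat \<Rightarrow> 'a::comm_ring_1 mat set" where
  "GL m = {g \<in> carrier_mat m m. invertible_mat g}"

definition J_mat :: "nat \<Rightarrow> 'a::comm_ring_1 mat" where
  "J_mat n = four_block_mat (0\<^sub>m n n) (1\<^sub>m n) (- 1\<^sub>m n) (0\<^sub>m n n)"

text \<open>The argument of \<open>Sp\<close> is half the size of the matrices.\<close>

definition Sp :: "nat \<Rightarrow> 'a::comm_ring_1 mat set" where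
  "Sp n = {g \<in> GL (2 * n). transpose_mat g * J_mat n * g = J_mat n}"

text \<open>The matrix \<open>M\<close> is invertible over the power series ring itself; the result is
  viewed as a set of matrices over the field of Laurent series.\<close>

definition Iwahori :: "nat \<Rightarrow> 'a::field fls mat set" where
  "Iwahori m = {map_mat fps_to_fls M | M :: 'a fps mat.
     M \<in> GL m \<and> upper_triangular (map_mat (\<lambda>f. fps_nth f 0) M)}"

definition double_cosets :: "'a::semiring_0 mat set \<Rightarrow> 'a mat set \<Rightarrow> 'a mat set \<Rightarrow> 'a mat set set" where
  "double_cosets H G L = (\<lambda>g. {h * g * l | h l. h \<in> H \<and> l \<in> L}) ` G"

definition monomial_mat :: "'a::zero mat \<Rightarrow> bool" where
  "monomial_mat A \<longleftrightarrow> square_mat A \<and>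
     (\<forall>i < dim_row A. \<exists>!j. j < dim_col A \<and> A $$ (i, j) \<noteq> 0) \<and>
     (\<forall>j < dim_col A. \<exists>!i. i < dim_row A \<and> A $$ (i, j) \<noteq> 0)"

definition SkewAPM :: "nat \<Rightarrow> 'a::field fls mat set" where
  "SkewAPM m = {w \<in> carrier_mat m m. transpose_mat w = - w \<and> monomial_mat w \<and>
     (\<forall>i j. i < j \<and> j < m \<and> w $$ (i, j) \<noteq> 0 \<longrightarrow> (\<exists>a::int. w $$ (i, j) = fls_X powi a))}"

end

theory Submission
  imports Defs "Jordan_Normal_Form.Determinant"
begin

text \<open>
  The map \<open>g \<mapsto> g\<^sup>T J g\<close> is constant on the cosets \<open>K g\<close> and separates them
  (\<open>GL_congruent_imp_Sp\<close>), and it turns right multiplication by \<open>b\<close> into the congruence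
  \<open>S \<mapsto> b\<^sup>T S b\<close> (\<open>congruence_mult\<close>). The double cosets of \<open>K\<close> and \<open>B\<close> thus correspond to
  \<open>B\<close>-congruence classes of invertible skew-symmetric matrices, and the claim becomes that every
  class contains exactly one element of \<open>SkewAPM\<close>, together with the fact that every such element
  has the form \<open>g\<^sup>T J g\<close> (\<open>SkewAPM_congruent_J_mat\<close>).

  Existence (\<open>reduce_to_SkewAPM\<close>) is symmetric Gaussian elimination. Adding multiples of columns to
  others is restricted by valuations, and choosing as pivot the entry that is first with respect to
  valuation, then row, then column makes every elimination step an element of \<open>B\<close>
  (\<open>obtain_pivot\<close>, \<open>elim_mat_in_Iwahori\<close>).

  Uniqueness (\<open>SkewAPM_unique\<close>) compares valuations in \<open>c\<^sup>T w' = w b\<close>, with \<open>c\<close> the inverse of \<open>b\<close>, where both sides have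
  entries that are single products; summed over all rows, the resulting inequalities must be
  equalities.

  Characteristic different from 2 enters only through the vanishing of the diagonal of a
  skew-symmetric matrix.
\<close>

section \<open>Invertible matrices\<close>

lemma GL_iff:
  "g \<in> GL m \<longleftrightarrow> g \<in> carrier_mat m m \<and> (\<exists>h \<in> carrier_mat m m. g * h = 1\<^sub>m m \<and> h * g = 1\<^sub>m m)"
proof
  assume "g \<in> GL m"
  then obtain h where g: "g \<in> carrier_mat m m"
    and h: "g * h = 1\<^sub>m m" "h * g = 1\<^sub>m (dim_row h)"
    by (auto simp: GL_def invertible_mat_def inverts_mat_def)
  have "h \<in> carrier_mat m m"
    using arg_cong[OF h(1), of dim_col] arg_cong[OF h(2), of dim_col] g by auto
  with g h show "g \<in> carrier_mat m m \<and> (\<exists>h \<in> carrier_mat m m. g * h = 1\<^sub>m m \<and> h * g = 1\<^sub>m m)"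
    by auto
qed (auto simp: GL_def invertible_mat_def inverts_mat_def)

lemma GL_carrier: "g \<in> GL m \<Longrightarrow> g \<in> carrier_mat m m"
  by (simp add: GL_def)

lemma GL_one: "1\<^sub>m m \<in> GL m"
  unfolding GL_iff by (auto intro!: bexI[of _ "1\<^sub>m m"])

lemma mult_mid_cancel:
  assumes "a \<in> carrier_mat m m" "b \<in> carrier_mat m m" "c \<in> carrier_mat m m" "d \<in> carrier_mat m m"
    and "b * c = 1\<^sub>m m"
  shows "(a * b) * (c * d) = (a * d :: 'a::comm_ring_1 mat)"
proof -
  have "(a * b) * (c * d) = a * ((b * c) * d)"
    using assms(1-4) by (simp add: assoc_mult_mat[where ?n\<^sub>1 = m and ?n\<^sub>2 = m and ?n\<^sub>3 = m and ?n\<^sub>4 = m])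
  then show ?thesis
    using assms by simp
qed

lemma GL_mult:
  assumes "a \<in> GL m" "b \<in> GL m"
  shows "a * b \<in> GL m"
proof -
  obtain a' b' where *: "a \<in> carrier_mat m m" "b \<in> carrier_mat m m"
    "a' \<in> carrier_mat m m" "b' \<in> carrier_mat m m"
    "a * a' = 1\<^sub>m m" "a' * a = 1\<^sub>m m" "b * b' = 1\<^sub>m m" "b' * b = 1\<^sub>m m"
    using assms by (auto simp: GL_iff)
  have "(a * b) * (b' * a') = 1\<^sub>m m" "(b' * a') * (a * b) = 1\<^sub>m m"
    using mult_mid_cancel[of a m b b' a'] mult_mid_cancel[of b' m a' a b] * by simp_all
  with * show ?thesis
    unfolding GL_iff by (intro conjI bexI[of _ "b' * a'"]) auto
qed

lemma GL_transpose:
  assumes "a \<in> GL m"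
  shows "transpose_mat a \<in> GL m"
proof -
  obtain a' where *: "a \<in> carrier_mat m m" "a' \<in> carrier_mat m m" "a * a' = 1\<^sub>m m" "a' * a = 1\<^sub>m m"
    using assms by (auto simp: GL_iff)
  then show ?thesis
    unfolding GL_iff
    by (auto intro!: bexI[of _ "transpose_mat a'"] simp flip: transpose_mult)
qed

lemma GL_iff_det_unit:
  "g \<in> GL m \<longleftrightarrow> g \<in> carrier_mat m m \<and> det g dvd 1"
proof
  assume "g \<in> GL m"
  then obtain h where *: "g \<in> carrier_mat m m" "h \<in> carrier_mat m m" "g * h = 1\<^sub>m m"
    by (auto simp: GL_iff)
  then have "det g * det h = 1"
    using det_mult[OF *(1,2)] by simp
  with * show "g \<in> carrier_mat m m \<and> det g dvd 1"
    by (metis dvd_triv_left)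
next
  assume *: "g \<in> carrier_mat m m \<and> det g dvd 1"
  then obtain u where u: "det g * u = 1"
    by (metis dvd_def)
  from * have g: "g \<in> carrier_mat m m" by simp
  have "g * (u \<cdot>\<^sub>m adj_mat g) = 1\<^sub>m m" "(u \<cdot>\<^sub>m adj_mat g) * g = 1\<^sub>m m"
    using adj_mat[OF g] g u
    by (auto simp: mult_smult_distrib[of _ m m] mult_smult_assoc_mat[of _ m m] mult.commute intro!: eq_matI)
  then show "g \<in> GL m"
    unfolding GL_iff using adj_mat(1)[OF g] g by (auto intro!: bexI[of _ "u \<cdot>\<^sub>m adj_mat g"])
qed

section \<open>Triangular matrices and the Iwahori subgroup\<close>

lemma upper_triangular_mult:
  assumes "a \<in> carrier_mat m m" "b \<in> carrier_mat m m" "upper_triangular a" "upper_triangular b"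
  shows "upper_triangular (a * b :: 'a::comm_ring_1 mat)"
proof (rule upper_triangularI)
  fix i j assume ij: "j < i" "i < dim_row (a * b)"
  have "a $$ (i, k) * b $$ (k, j) = 0" if "k < m" for k
    using that ij assms upper_triangularD[OF assms(3), of k i] upper_triangularD[OF assms(4), of j k]
    by (cases "k < i") auto
  then show "(a * b) $$ (i, j) = 0"
    using assms ij by (auto simp: scalar_prod_def intro!: sum.neutral)
qed

lemma upper_triangular_diag_nonzero:
  fixes a :: "'a::field mat"
  assumes "a \<in> carrier_mat m m" "upper_triangular a" "a \<in> GL m" "i < m"
  shows "a $$ (i, i) \<noteq> 0"
proof -
  have "det a \<noteq> 0"
    using assms(3) by (auto simp: GL_iff_det_unit)
  then have "0 \<notin> set (diag_mat a)"
    using assms det_upper_triangular[of a m] by (simp add: prod_list_zero_iff)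
  then show ?thesis
    using assms unfolding diag_mat_def by (auto simp: image_iff)
qed

text \<open>In each column of the inverse the entries below the diagonal are shown to vanish from the bottom
  row upwards, by solving \<open>a * b = 1\<close> backwards.\<close>

lemma upper_triangular_inverse:
  fixes a :: "'a::field mat"
  assumes a: "a \<in> carrier_mat m m" and b: "b \<in> carrier_mat m m"
    and ut: "upper_triangular a" and ab: "a * b = 1\<^sub>m m" and ba: "b * a = 1\<^sub>m m"
  shows "upper_triangular b"
proof (rule upper_triangularI)
  fix i j assume ij: "j < i" "i < dim_row b"
  show "b $$ (i, j) = 0"
    using ij
  proof (induction "m - i" arbitrary: i rule: less_induct)
    case less
    have i: "i < m" using less b by simp
    have aii: "a $$ (i, i) \<noteq> 0"
      using upper_triangular_diag_nonzero[OF a ut _ i] a b ab ba GL_iff by blast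
    have "0 = (a * b) $$ (i, j)"
      using ab less i by simp
    also have "\<dots> = (\<Sum>k<m. a $$ (i, k) * b $$ (k, j))"
      using a b i less by (auto simp: scalar_prod_def lessThan_atLeast0)
    also have "\<dots> = (\<Sum>k<m. if k = i then a $$ (i, i) * b $$ (i, j) else 0)"
    proof (rule sum.cong[OF refl])
      fix k assume "k \<in> {..<m}"
      then show "a $$ (i, k) * b $$ (k, j) = (if k = i then a $$ (i, i) * b $$ (i, j) else 0)"
        using less.hyps[of k] less.prems ut a b i by (cases k i rule: linorder_cases) auto
    qed
    also have "\<dots> = a $$ (i, i) * b $$ (i, j)"
      using i by simp
    finally show ?case using aii by simp
  qed
qed

interpretation fps_to_fls_hom: comm_ring_hom "fps_to_fls :: 'a::field fps \<Rightarrow> 'a fls"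
  by unfold_locales (auto simp: fls_times_fps_to_fls)

interpretation fps_const_term_hom: comm_ring_hom "\<lambda>f :: 'a::field fps. fps_nth f 0"
  by unfold_locales auto

lemma map_mat_GL:
  assumes "comm_ring_hom h" "M \<in> GL m"
  shows "map_mat h M \<in> GL m"
proof -
  interpret comm_ring_hom h by fact
  obtain N where *: "M \<in> carrier_mat m m" "N \<in> carrier_mat m m" "M * N = 1\<^sub>m m" "N * M = 1\<^sub>m m"
    using assms(2) by (auto simp: GL_iff)
  then show ?thesis
    unfolding GL_iff
    by (auto intro!: bexI[of _ "map_mat h N"] simp: mat_hom_one simp flip: mat_hom_mult)
qed

lemma Iwahori_subset_GL: "Iwahori m \<subseteq> GL m"
  by (auto simp: Iwahori_def intro: map_mat_GL[OF fps_to_fls_hom.comm_ring_hom_axioms])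

lemma Iwahori_one: "1\<^sub>m m \<in> Iwahori m"
  unfolding Iwahori_def
  by (auto intro!: exI[of _ "1\<^sub>m m"] simp: fps_to_fls_hom.mat_hom_one fps_const_term_hom.mat_hom_one GL_one)

lemma Iwahori_mult:
  assumes "a \<in> Iwahori m" "b \<in> Iwahori m"
  shows "a * b \<in> Iwahori m"
proof -
  obtain M N where *: "a = map_mat fps_to_fls M" "b = map_mat fps_to_fls N" "M \<in> GL m" "N \<in> GL m"
    "upper_triangular (map_mat (\<lambda>f. fps_nth f 0) M)" "upper_triangular (map_mat (\<lambda>f. fps_nth f 0) N)"
    using assms by (auto simp: Iwahori_def)
  then have c: "M \<in> carrier_mat m m" "N \<in> carrier_mat m m"
    by (auto dest: GL_carrier)
  have "upper_triangular (map_mat (\<lambda>f. fps_nth f 0) (M * N))"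
    using fps_const_term_hom.mat_hom_mult[OF c] c * by (simp add: upper_triangular_mult[of _ m])
  moreover have "a * b = map_mat fps_to_fls (M * N)"
    using fps_to_fls_hom.mat_hom_mult[OF c] * by simp
  ultimately show ?thesis
    using * GL_mult unfolding Iwahori_def by blast
qed

lemma Iwahori_inverse:
  assumes "a \<in> Iwahori m"
  obtains b where "b \<in> Iwahori m" "a * b = 1\<^sub>m m" "b * a = 1\<^sub>m m"
proof -
  obtain M where *: "a = map_mat fps_to_fls M" "M \<in> GL m"
    "upper_triangular (map_mat (\<lambda>f. fps_nth f 0) M)"
    using assms by (auto simp: Iwahori_def)
  then obtain N where c: "M \<in> carrier_mat m m" "N \<in> carrier_mat m m" "M * N = 1\<^sub>m m" "N * M = 1\<^sub>m m"
    by (auto simp: GL_iff)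
  have "upper_triangular (map_mat (\<lambda>f. fps_nth f 0) N)"
  proof (rule upper_triangular_inverse)
    show "map_mat (\<lambda>f. fps_nth f 0) M * map_mat (\<lambda>f. fps_nth f 0) N = 1\<^sub>m m"
      "map_mat (\<lambda>f. fps_nth f 0) N * map_mat (\<lambda>f. fps_nth f 0) M = 1\<^sub>m m"
      using c by (simp_all add: fps_const_term_hom.mat_hom_one flip: fps_const_term_hom.mat_hom_mult)
  qed (use c * in auto)
  moreover have "N \<in> GL m"
    using c by (auto simp: GL_iff)
  ultimately have "map_mat fps_to_fls N \<in> Iwahori m"
    by (auto simp: Iwahori_def)
  moreover have "a * map_mat fps_to_fls N = 1\<^sub>m m" "map_mat fps_to_fls N * a = 1\<^sub>m m"
    using c * by (simp_all add: fps_to_fls_hom.mat_hom_one flip: fps_to_fls_hom.mat_hom_mult)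
  ultimately show ?thesis ..
qed

text \<open>The disjunct \<open>f = 0\<close> cannot be absorbed into the other one, because \<open>fls_subdegree 0 = 0\<close>.\<close>

lemma fps_nth_0_eq_0_iff:
  "fps_nth (f :: 'a::field fps) 0 = 0 \<longleftrightarrow> f = 0 \<or> 1 \<le> fls_subdegree (fps_to_fls f)"
  by (auto simp: fls_subdegree_fls_to_fps subdegree_eq_0_iff Suc_le_eq)

text \<open>Valuation description of the Iwahori subgroup: all entries are integral, the ones below the
  diagonal are divisible by the uniformizer, and the diagonal entries are units. These conditions
  suffice, since they make the determinant at \<open>t = 0\<close> a product of non-zero constants, hence the
  determinant a unit of the power series ring. The bounds are stated for non-zero entries only
  because \<open>fls_subdegree 0 = 0\<close>.\<close>

lemma Iwahori_iff:
  fixes b :: "'a::field fls mat"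
  shows "b \<in> Iwahori m \<longleftrightarrow> b \<in> carrier_mat m m \<and>
    (\<forall>i<m. \<forall>j<m. b $$ (i, j) \<noteq> 0 \<longrightarrow> of_bool (j < i) \<le> fls_subdegree (b $$ (i, j))) \<and>
    (\<forall>i<m. b $$ (i, i) \<noteq> 0 \<and> fls_subdegree (b $$ (i, i)) = 0)"
  (is "_ \<longleftrightarrow> ?R")
proof
  assume "b \<in> Iwahori m"
  then obtain M where *: "b = map_mat fps_to_fls M" "M \<in> GL m"
    "upper_triangular (map_mat (\<lambda>f. fps_nth f 0) M)"
    by (auto simp: Iwahori_def)
  have c: "M \<in> carrier_mat m m" using * GL_carrier by blast
  have "fps_nth (M $$ (i, i)) 0 \<noteq> 0" if "i < m" for i
    using upper_triangular_diag_nonzero[OF _ *(3), of m i] that c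
      map_mat_GL[OF fps_const_term_hom.comm_ring_hom_axioms *(2)] by auto
  then have diag: "M $$ (i, i) \<noteq> 0 \<and> fls_subdegree (fps_to_fls (M $$ (i, i))) = 0" if "i < m" for i
    using that by (force simp: fls_subdegree_fls_to_fps)
  have "fps_nth (M $$ (i, j)) 0 = 0" if "j < i" "i < m" for i j
    using *(3) c that by (auto dest: upper_triangularD)
  then have low: "M $$ (i, j) = 0 \<or> 1 \<le> fls_subdegree (fps_to_fls (M $$ (i, j)))" if "j < i" "i < m" for i j
    using that fps_nth_0_eq_0_iff by blast
  show ?R
    using c diag low *(1) by (auto simp: fls_subdegree_fls_to_fps_gt0 of_bool_def)
next
  assume R: ?R
  define M where "M = map_mat fls_regpart b"
  have c: "b \<in> carrier_mat m m" "M \<in> carrier_mat m m"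
    using R by (auto simp: M_def)
  have e: "fps_to_fls (M $$ (i, j)) = b $$ (i, j)" if "i < m" "j < m" for i j
  proof -
    have "0 \<le> fls_subdegree (b $$ (i, j))"
      using R[THEN conjunct2, THEN conjunct1, rule_format, of i j] that
      by (cases "b $$ (i, j) = 0") (auto split: if_splits simp: of_bool_def)
    then show ?thesis using that c by (simp add: M_def)
  qed
  have b: "b = map_mat fps_to_fls M"
    by (rule eq_matI) (use c e in auto)
  have ut: "upper_triangular (map_mat (\<lambda>f. fps_nth f 0) M)"
  proof (rule upper_triangularI)
    fix i j assume "j < i" "i < dim_row (map_mat (\<lambda>f. fps_nth f 0) M)"
    then have ij: "j < i" "i < m" "j < m" using c by auto
    then have "M $$ (i, j) = 0 \<or> 1 \<le> fls_subdegree (fps_to_fls (M $$ (i, j)))"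
      using R[THEN conjunct2, THEN conjunct1, rule_format, of i j] e[of i j]
      by (cases "b $$ (i, j) = 0") auto
    then show "map_mat (\<lambda>f. fps_nth f 0) M $$ (i, j) = 0"
      using fps_nth_0_eq_0_iff[of "M $$ (i, j)"] ij c by simp
  qed
  have nz: "fps_nth (M $$ (i, i)) 0 \<noteq> 0" if "i < m" for i
    using that R e[of i i] fps_nth_0_eq_0_iff[of "M $$ (i, i)"] by auto
  have "det (map_mat (\<lambda>f. fps_nth f 0) M) \<noteq> 0"
    using det_upper_triangular[OF ut, of m] c nz by (auto simp: prod_list_zero_iff diag_mat_def)
  then have "M \<in> GL m"
    using c by (simp add: GL_iff_det_unit fps_const_term_hom.hom_det)
  with ut b show "b \<in> Iwahori m"
    by (auto simp: Iwahori_def)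
qed

section \<open>Skew-symmetric matrices and congruence\<close>

lemma quadratically_closed_two_neq_0:
  assumes "quadratically_closed TYPE('a::field)"
  shows "(2 :: 'a fls) \<noteq> 0"
proof -
  have "CHAR('a) \<noteq> 1" by simp
  then have "\<not> CHAR('a) dvd 2"
    using assms two_is_prime_nat by (auto simp: quadratically_closed_def prime_nat_iff)
  then have "of_nat 2 \<noteq> (0::'a)"
    by (metis of_nat_eq_0_iff_char_dvd)
  then have "fls_nth (2 :: 'a fls) 0 \<noteq> 0"
    by simp
  then show ?thesis by force
qed

lemma skew_entry:
  assumes "transpose_mat S = - S" "S \<in> carrier_mat m m" "i < m" "j < m"
  shows "S $$ (i, j) = - (S $$ (j, i) :: 'a::comm_ring_1)"
  using arg_cong[OF assms(1), of "\<lambda>M. M $$ (j, i)"] assms(2-) by simp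

lemma skew_diag_zero:
  assumes "transpose_mat S = - S" "S \<in> carrier_mat m m" "i < m" "(2 :: 'a::idom) \<noteq> 0"
  shows "S $$ (i, i) = (0 :: 'a)"
proof -
  have "S $$ (i, i) + S $$ (i, i) = 0"
    using skew_entry[OF assms(1-3,3)] by (metis add.right_inverse)
  then show ?thesis
    using assms(4) by (simp flip: mult_2)
qed

lemma skew_congruence:
  assumes "transpose_mat S = - S" "S \<in> carrier_mat m m" "b \<in> carrier_mat m m"
  shows "transpose_mat (transpose_mat b * S * b) = - (transpose_mat b * S * b :: 'a::comm_ring_1 mat)"
proof -
  have "transpose_mat (transpose_mat b * S * b) = transpose_mat b * (transpose_mat S * b)"
    using assms(2,3) by (simp add: transpose_mult[of _ m m _ m])
  also have "\<dots> = - (transpose_mat b * S * b)"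
    using assms by (simp add: assoc_mult_mat[of _ m m _ m _ m])
  finally show ?thesis .
qed

lemma GL_row_nonzero:
  assumes "S \<in> GL m" "i < m"
  obtains j where "j < m" "S $$ (i, j) \<noteq> (0 :: 'a::comm_ring_1)"
proof -
  obtain R where R: "S \<in> carrier_mat m m" "R \<in> carrier_mat m m" "S * R = 1\<^sub>m m"
    using assms by (auto simp: GL_iff)
  have "(\<Sum>k\<in>{0..<m}. S $$ (i, k) * R $$ (k, i)) = (S * R) $$ (i, i)"
    using R(1,2) assms(2) by (simp add: scalar_prod_def)
  also have "\<dots> = 1"
    using R(3) assms(2) by simp
  finally have "(\<Sum>k\<in>{0..<m}. S $$ (i, k) * R $$ (k, i)) = 1" .
  then have "\<exists>j<m. S $$ (i, j) \<noteq> 0"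
    by (metis (no_types, lifting) atLeastLessThan_iff mult_zero_left sum.neutral zero_neq_one)
  then show ?thesis using that by blast
qed

section \<open>Reduction to monomial form\<close>

text \<open>The base change that splits off the plane spanned by the basis vectors \<open>e\<^sub>i\<close> and \<open>e\<^sub>j\<close> when the
  form \<open>S\<close> has a non-zero pivot at \<open>(i, j)\<close>: every other \<open>e\<^sub>l\<close> is replaced by
  \<open>e\<^sub>l - (S\<^sub>j\<^sub>l / S\<^sub>j\<^sub>i) e\<^sub>i - (S\<^sub>i\<^sub>l / S\<^sub>i\<^sub>j) e\<^sub>j\<close>, which is orthogonal to \<open>e\<^sub>i\<close> and \<open>e\<^sub>j\<close>,
  and \<open>e\<^sub>j\<close> is rescaled by the unit that turns the pivot into a power of \<open>t\<close>.
  The columns of the matrix are the new basis vectors.\<close>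

definition elim_mat :: "nat \<Rightarrow> 'a::field fls mat \<Rightarrow> nat \<Rightarrow> nat \<Rightarrow> 'a fls mat" where
  "elim_mat m S i j = mat m m (\<lambda>(k, l).
     of_bool (k = l) * (if l = j then fls_X powi fls_subdegree (S $$ (i, j)) / S $$ (i, j) else 1)
     - of_bool (k = i \<and> l \<notin> {i, j}) * (S $$ (j, l) / S $$ (j, i))
     - of_bool (k = j \<and> l \<notin> {i, j}) * (S $$ (i, l) / S $$ (i, j)))"

lemma elim_mat_carrier [simp]: "elim_mat m S i j \<in> carrier_mat m m"
  by (simp add: elim_mat_def)

text \<open>The base change lies in the Iwahori subgroup if the pivot has minimal valuation in rows \<open>i\<close> and
  \<open>j\<close> and, among the entries attaining the minimum, is the leftmost one in row \<open>i\<close>, as its mirror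
  image \<open>(j, i)\<close> is in row \<open>j\<close>: a multiple of column \<open>j\<close> may be added to a column \<open>l < j\<close> only
  with a coefficient divisible by \<open>t\<close>.\<close>

lemma elim_mat_in_Iwahori:
  assumes "i < j" "j < m" "S $$ (i, j) \<noteq> 0" "S $$ (j, i) = - S $$ (i, j)"
    and row_i: "\<forall>l<m. S $$ (i, l) \<noteq> 0 \<longrightarrow>
       fls_subdegree (S $$ (i, j)) + of_bool (l < j) \<le> fls_subdegree (S $$ (i, l))"
    and row_j: "\<forall>l<m. S $$ (j, l) \<noteq> 0 \<longrightarrow>
       fls_subdegree (S $$ (i, j)) + of_bool (l < i) \<le> fls_subdegree (S $$ (j, l))"
  shows "elim_mat m S i j \<in> Iwahori m"
proof -
  let ?d = "fls_subdegree (S $$ (i, j))"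
  have unit: "fls_subdegree (fls_X powi ?d / S $$ (i, j)) = 0" "fls_X powi ?d / S $$ (i, j) \<noteq> 0"
    using assms by (simp_all add: fls_divide_subdegree del: fls_X_power_int)
  have i: "of_bool (l < j) \<le> fls_subdegree (S $$ (i, l) / S $$ (i, j))" if "l < m" "S $$ (i, l) \<noteq> 0" for l
    using row_i[rule_format, OF that] that assms(1-4) by (cases "l < j") (simp_all add: fls_divide_subdegree)
  have j: "of_bool (l < i) \<le> fls_subdegree (S $$ (j, l) / S $$ (j, i))" if "l < m" "S $$ (j, l) \<noteq> 0" for l
    using row_j[rule_format, OF that] that assms(1-4) by (cases "l < i") (simp_all add: fls_divide_subdegree)
  have "of_bool (l < k) \<le> fls_subdegree (elim_mat m S i j $$ (k, l))"
    if kl: "k < m" "l < m" "elim_mat m S i j $$ (k, l) \<noteq> 0" for k l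
  proof -
    consider "k = l" | "k = i" "l \<notin> {i, j}" | "k = j" "l \<notin> {i, j}" | "elim_mat m S i j $$ (k, l) = 0"
      using kl(1,2) assms(1)
      by (cases "l \<in> {i, j}"; cases "k = l"; cases "k = i"; cases "k = j")
        (auto simp: elim_mat_def simp del: fls_X_power_int)
    then show ?thesis
    proof cases
      case 1
      then show ?thesis using kl unit by (simp add: elim_mat_def del: fls_X_power_int)
    next
      case 2
      then show ?thesis using kl assms(1) j[of l] by (simp add: elim_mat_def del: fls_X_power_int)
    next
      case 3
      then show ?thesis using kl assms(1) i[of l] by (simp add: elim_mat_def del: fls_X_power_int)
    qed (use kl in simp)
  qed
  moreover have "elim_mat m S i j $$ (k, k) \<noteq> 0 \<and> fls_subdegree (elim_mat m S i j $$ (k, k)) = 0" if "k < m" for k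
    using unit that by (auto simp: elim_mat_def simp del: fls_X_power_int)
  ultimately show ?thesis
    by (simp add: Iwahori_iff)
qed

lemma sum_delta3:
  fixes f :: "nat \<Rightarrow> 'a::comm_ring_1"
  assumes "p < m" "q < m" "r < m"
  shows "(\<Sum>k = 0..<m. f k * (of_bool (k = p) * x - of_bool (k = q \<and> P) * y - of_bool (k = r \<and> Q) * z))
    = f p * x - of_bool P * f q * y - of_bool Q * f r * z"
proof -
  have "(\<Sum>k = 0..<m. f k * (of_bool (k = p) * x - of_bool (k = q \<and> P) * y - of_bool (k = r \<and> Q) * z))
    = (\<Sum>k = 0..<m. (if k = p then f p * x else 0) - (if k = q then of_bool P * f q * y else 0)
         - (if k = r then of_bool Q * f r * z else 0))"
    by (rule sum.cong) (auto simp: algebra_simps)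
  then show ?thesis
    using assms by (simp add: sum_subtractf)
qed

lemma elim_mat_mult_entry:
  assumes "A \<in> carrier_mat m m" "i < m" "j < m" "r < m" "l < m"
  shows "(A * elim_mat m S i j) $$ (r, l) =
     A $$ (r, l) * (if l = j then fls_X powi fls_subdegree (S $$ (i, j)) / S $$ (i, j) else 1)
     - of_bool (l \<notin> {i, j}) * A $$ (r, i) * (S $$ (j, l) / S $$ (j, i))
     - of_bool (l \<notin> {i, j}) * A $$ (r, j) * (S $$ (i, l) / S $$ (i, j))"
proof -
  have "(A * elim_mat m S i j) $$ (r, l) = (\<Sum>k = 0..<m. A $$ (r, k) * elim_mat m S i j $$ (k, l))"
    using assms by (auto simp: scalar_prod_def elim_mat_def intro!: sum.cong)
  also have "\<dots> = (\<Sum>k = 0..<m. A $$ (r, k) *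
     (of_bool (k = l) * (if l = j then fls_X powi fls_subdegree (S $$ (i, j)) / S $$ (i, j) else 1)
     - of_bool (k = i \<and> l \<notin> {i, j}) * (S $$ (j, l) / S $$ (j, i))
     - of_bool (k = j \<and> l \<notin> {i, j}) * (S $$ (i, l) / S $$ (i, j))))"
    using assms by (intro sum.cong) (auto simp: elim_mat_def)
  also note sum_delta3[OF assms(5,2,3)]
  finally show ?thesis .
qed

lemma elim_congruence_entries:
  fixes S :: "'a::field fls mat"
  assumes S: "S \<in> carrier_mat m m" and skew: "transpose_mat S = - S" and two: "(2::'a fls) \<noteq> 0"
    and ij: "i < m" "j < m" "i \<noteq> j" "S $$ (i, j) \<noteq> 0"
  defines "S' \<equiv> transpose_mat (elim_mat m S i j) * S * elim_mat m S i j"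
  shows "\<And>l. l < m \<Longrightarrow>
      S' $$ (i, l) = (if l = j then fls_X powi fls_subdegree (S $$ (i, j)) else 0)"
    and "\<And>l. l < m \<Longrightarrow>
      S' $$ (j, l) = (if l = i then - (fls_X powi fls_subdegree (S $$ (i, j))) else 0)"
    and "\<And>r l. r < m \<Longrightarrow> l < m \<Longrightarrow> r \<notin> {i, j} \<Longrightarrow> l \<notin> {i, j} \<Longrightarrow>
      S' $$ (r, l) = S $$ (r, l) - S $$ (r, i) * (S $$ (j, l) / S $$ (j, i))
        - S $$ (r, j) * (S $$ (i, l) / S $$ (i, j))"
proof -
  let ?b = "elim_mat m S i j" and ?u = "fls_X powi fls_subdegree (S $$ (i, j)) / S $$ (i, j)"
  define X where "X = S * ?b"
  have X: "X \<in> carrier_mat m m"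
    using S by (simp add: X_def)
  have S': "S' = transpose_mat ?b * X"
    using S by (simp add: S'_def X_def assoc_mult_mat[of _ m m _ m _ m])
  have entry: "S' $$ (r, l) = (transpose_mat X * ?b) $$ (l, r)" if "r < m" "l < m" for r l
  proof -
    have "S' = transpose_mat (transpose_mat X * ?b)"
      using X by (simp add: S' transpose_mult[of _ m m _ m])
    then show ?thesis using that X by (simp add: elim_mat_def)
  qed
  note skew' = skew_entry[OF skew S]
  note diag = skew_diag_zero[OF skew S _ two]
  have ji: "S $$ (j, i) = - S $$ (i, j)" using skew' ij by blast
  have Xi: "X $$ (i, l) = (if l = j then fls_X powi fls_subdegree (S $$ (i, j)) else 0)" if "l < m" for l
    using that ij diag elim_mat_mult_entry[OF S ij(1,2,1) that, of S] by (auto simp: X_def simp del: fls_X_power_int)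
  have Xj: "X $$ (j, l) = (if l = i then S $$ (j, i) else 0)" if "l < m" for l
    using that ij diag ji elim_mat_mult_entry[OF S ij(1,2,2) that, of S] by (auto simp: X_def simp del: fls_X_power_int)
  have Xr: "X $$ (r, l) = S $$ (r, l) - S $$ (r, i) * (S $$ (j, l) / S $$ (j, i))
        - S $$ (r, j) * (S $$ (i, l) / S $$ (i, j))" if "r < m" "l < m" "l \<notin> {i, j}" for r l
    using that ij elim_mat_mult_entry[OF S ij(1,2) that(1,2), of S] by (auto simp: X_def simp del: fls_X_power_int)
  have e: "S' $$ (r, l) = X $$ (r, l) * (if r = j then ?u else 1)
     - of_bool (r \<notin> {i, j}) * X $$ (i, l) * (S $$ (j, r) / S $$ (j, i))
     - of_bool (r \<notin> {i, j}) * X $$ (j, l) * (S $$ (i, r) / S $$ (i, j))" if "r < m" "l < m" for r l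
  proof -
    have "S' $$ (r, l) = (transpose_mat X * ?b) $$ (l, r)"
      using entry[OF that] .
    also note elim_mat_mult_entry[of "transpose_mat X" m i j l r S, OF _ ij(1,2) that(2,1)]
    finally show ?thesis
      using X that ij by (auto simp del: fls_X_power_int)
  qed
  show "S' $$ (i, l) = (if l = j then fls_X powi fls_subdegree (S $$ (i, j)) else 0)" if "l < m" for l
    using e[OF ij(1) that] Xi[OF that] ij by (simp del: fls_X_power_int)
  show "S' $$ (j, l) = (if l = i then - (fls_X powi fls_subdegree (S $$ (i, j))) else 0)" if "l < m" for l
    using e[OF ij(2) that] Xj[OF that] ij ji by (simp del: fls_X_power_int)
  show "S' $$ (r, l) = S $$ (r, l) - S $$ (r, i) * (S $$ (j, l) / S $$ (j, i))
        - S $$ (r, j) * (S $$ (i, l) / S $$ (i, j))" if "r < m" "l < m" "r \<notin> {i, j}" "l \<notin> {i, j}" for r l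
    using e[OF that(1,2)] Xi[OF that(2)] Xj[OF that(2)] Xr[OF that(1,2,4)] that
    by (simp del: fls_X_power_int)
qed

lemma congruence_mult:
  assumes "S \<in> carrier_mat m m" "b \<in> carrier_mat m m" "c \<in> carrier_mat m m"
  shows "transpose_mat (b * c) * S * (b * c) = transpose_mat c * (transpose_mat b * S * b) * (c :: 'a::comm_ring_1 mat)"
  using assms by (simp add: transpose_mult[of _ m m _ m] assoc_mult_mat[of _ m m _ m _ m])

text \<open>A suitable pivot is the entry that comes first when the non-zero entries in the rows indexed by
  \<open>T\<close> are ordered lexicographically by valuation, row and column. By skew-symmetry it lies above
  the diagonal.\<close>

lemma obtain_pivot:
  fixes S :: "'a::field fls mat"
  assumes S: "S \<in> carrier_mat m m" and skew: "transpose_mat S = - S"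
    and ex: "r\<^sub>0 < m" "l\<^sub>0 < m" "S $$ (r\<^sub>0, l\<^sub>0) \<noteq> 0" "r\<^sub>0 \<in> T"
    and T: "\<And>r l. r < m \<Longrightarrow> l < m \<Longrightarrow> r \<in> T \<Longrightarrow> l \<notin> T \<Longrightarrow> S $$ (r, l) = 0"
    and two: "(2 :: 'a fls) \<noteq> 0"
  obtains i j where "i < j" "j < m" "i \<in> T" "j \<in> T" "S $$ (i, j) \<noteq> 0"
    "\<forall>l<m. S $$ (i, l) \<noteq> 0 \<longrightarrow>
       fls_subdegree (S $$ (i, j)) + of_bool (l < j) \<le> fls_subdegree (S $$ (i, l))"
    "\<forall>l<m. S $$ (j, l) \<noteq> 0 \<longrightarrow>
       fls_subdegree (S $$ (i, j)) + of_bool (l < i) \<le> fls_subdegree (S $$ (j, l))"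
proof -
  note skew' = skew_entry[OF skew S]
  define V where "V = {(r, l). r < m \<and> l < m \<and> r \<in> T \<and> S $$ (r, l) \<noteq> 0}"
  define sd where "sd = (\<lambda>(r, l). fls_subdegree (S $$ (r, l)))"
  have "finite V"
    by (rule finite_subset[of _ "{..<m} \<times> {..<m}"]) (auto simp: V_def)
  moreover have "V \<noteq> {}"
    using ex by (auto simp: V_def)
  ultimately obtain p where p: "p \<in> V" "\<And>q. q \<in> V \<Longrightarrow> sd p \<le> sd q"
    using arg_min_if_finite(1)[of V sd] arg_min_least[of V _ sd] by blast
  define i where "i = (LEAST i. \<exists>l. (i, l) \<in> V \<and> sd (i, l) = sd p)"
  have i: "\<exists>l. (i, l) \<in> V \<and> sd (i, l) = sd p"
    unfolding i_def by (rule LeastI_ex) (metis p(1) surj_pair)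
  define j where "j = (LEAST j. (i, j) \<in> V \<and> sd (i, j) = sd p)"
  have j: "(i, j) \<in> V" "sd (i, j) = sd p"
    using LeastI_ex[OF i] by (auto simp: j_def)
  have i_min: "i \<le> r" if "(r, l) \<in> V" "sd (r, l) = sd p" for r l
    unfolding i_def by (rule Least_le) (use that in blast)
  have j_min: "j \<le> l" if "(i, l) \<in> V" "sd (i, l) = sd p" for l
    unfolding j_def by (rule Least_le) (use that in blast)
  have ij: "i < m" "j < m" "i \<in> T" "S $$ (i, j) \<noteq> 0" "j \<in> T"
    using j T by (auto simp: V_def)
  have swap: "(l, r) \<in> V \<and> sd (l, r) = sd (r, l)" if "(r, l) \<in> V" for r l
    using that T skew'[of l r] by (auto simp: V_def sd_def)
  have "i \<noteq> j"
    using skew_diag_zero[OF skew S ij(1) two] ij(4) by auto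
  moreover have "i \<le> j"
    using swap[OF j(1)] j i_min[of j i] by simp
  ultimately have "i < j" by simp
  moreover have "fls_subdegree (S $$ (i, j)) + of_bool (l < j) \<le> fls_subdegree (S $$ (i, l))"
    if "l < m" "S $$ (i, l) \<noteq> 0" for l
  proof -
    have "(i, l) \<in> V" using that ij by (simp add: V_def)
    then have "sd p \<le> sd (i, l)" "sd (i, l) = sd p \<Longrightarrow> j \<le> l"
      using p j_min by auto
    then show ?thesis using j(2) by (cases "l < j"; cases "sd (i, l) = sd p") (auto simp: sd_def)
  qed
  moreover have "fls_subdegree (S $$ (i, j)) + of_bool (l < i) \<le> fls_subdegree (S $$ (j, l))"
    if "l < m" "S $$ (j, l) \<noteq> 0" for l
  proof -
    have "(j, l) \<in> V" using that ij by (simp add: V_def)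
    then have "sd p \<le> sd (j, l)" "sd (j, l) = sd p \<Longrightarrow> i \<le> l"
      using p i_min swap[of j l] by auto
    then show ?thesis using j(2) by (cases "l < i"; cases "sd (j, l) = sd p") (auto simp: sd_def)
  qed
  ultimately show ?thesis
    using that ij by blast
qed

text \<open>Here \<open>T\<close> is the set of indices still to be treated. The hypotheses say that the rows outside \<open>T\<close>
  already have the shape required in \<open>SkewAPM\<close> and that \<open>S\<close> is block diagonal with respect to
  \<open>T\<close> and its complement. Each step removes the two pivot indices from \<open>T\<close>.\<close>

lemma reduce_to_SkewAPM:
  fixes S :: "'a::field fls mat"
  assumes two: "(2 :: 'a fls) \<noteq> 0"
    and "S \<in> GL m" "transpose_mat S = - S" "T \<subseteq> {..<m}"
    and "\<And>r. r < m \<Longrightarrow> r \<notin> T \<Longrightarrow> \<exists>!l. l < m \<and> S $$ (r, l) \<noteq> 0"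
    and "\<And>r l. r < m \<Longrightarrow> r \<notin> T \<Longrightarrow> l \<in> T \<Longrightarrow> S $$ (r, l) = 0"
    and "\<And>r l. r < l \<Longrightarrow> l < m \<Longrightarrow> r \<notin> T \<Longrightarrow> S $$ (r, l) \<noteq> 0 \<Longrightarrow> \<exists>a. S $$ (r, l) = fls_X powi a"
  shows "\<exists>b \<in> Iwahori m. transpose_mat b * S * b \<in> SkewAPM m"
  using assms(2-)
proof (induction "card T" arbitrary: S T rule: less_induct)
  case less
  note S_GL = less.prems(1) and skew = less.prems(2) and T_sub = less.prems(3)
    and uniq = less.prems(4) and block = less.prems(5) and pow = less.prems(6)
  have S: "S \<in> carrier_mat m m" using S_GL GL_carrier by blast
  note skew' = skew_entry[OF skew S]
  show ?case
  proof (cases "T = {}")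
    case True
    have row: "\<exists>!j. j < m \<and> S $$ (i, j) \<noteq> 0" if "i < m" for i
      using uniq that True by simp
    have col: "\<exists>!j. j < m \<and> S $$ (j, i) \<noteq> 0" if "i < m" for i
    proof -
      have "(j < m \<and> S $$ (j, i) \<noteq> 0) = (j < m \<and> S $$ (i, j) \<noteq> 0)" for j
        using skew'[of i j] that by auto
      then show ?thesis using row[OF that] by simp
    qed
    have "S \<in> SkewAPM m"
      unfolding SkewAPM_def monomial_mat_def
      using S skew row col pow True by (auto simp del: fls_X_power_int)
    then show ?thesis
      using S by (intro bexI[of _ "1\<^sub>m m"] Iwahori_one) simp
  next
    case False
    then obtain r\<^sub>0 where r0: "r\<^sub>0 \<in> T" "r\<^sub>0 < m" using T_sub by blast
    obtain l\<^sub>0 where l0: "l\<^sub>0 < m" "S $$ (r\<^sub>0, l\<^sub>0) \<noteq> 0" using GL_row_nonzero[OF S_GL r0(2)] .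
    have block': "S $$ (r, l) = 0" if "r < m" "l < m" "r \<in> T" "l \<notin> T" for r l
      using block[of l r] skew'[of r l] that by simp
    obtain i j where ij: "i < j" "j < m" "i \<in> T" "j \<in> T" "S $$ (i, j) \<noteq> 0"
      and row_i: "\<forall>l<m. S $$ (i, l) \<noteq> 0 \<longrightarrow>
         fls_subdegree (S $$ (i, j)) + of_bool (l < j) \<le> fls_subdegree (S $$ (i, l))"
      and row_j: "\<forall>l<m. S $$ (j, l) \<noteq> 0 \<longrightarrow>
         fls_subdegree (S $$ (i, j)) + of_bool (l < i) \<le> fls_subdegree (S $$ (j, l))"
      by (rule obtain_pivot[OF S skew r0(2) l0 r0(1) block' two]) blast
    have im: "i < m" "i \<noteq> j" using ij by simp_all
    let ?b = "elim_mat m S i j"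
    have b: "?b \<in> Iwahori m"
      using elim_mat_in_Iwahori[OF ij(1,2,5) skew'[OF ij(2) im(1)] row_i row_j] .
    then have b_GL: "?b \<in> GL m" using Iwahori_subset_GL by blast
    define S' where "S' = transpose_mat ?b * S * ?b"
    define T' where "T' = T - {i, j}"
    note entries = elim_congruence_entries[OF S skew two im(1) ij(2) im(2) ij(5), folded S'_def]
    have S'_skew: "transpose_mat S' = - S'"
      unfolding S'_def by (rule skew_congruence[OF skew S]) simp
    have S'_GL: "S' \<in> GL m"
      unfolding S'_def by (intro GL_mult GL_transpose b_GL S_GL)
    note S'_skew' = skew_entry[OF S'_skew GL_carrier[OF S'_GL]]
    \<comment> \<open>Rows treated earlier are orthogonal to \<open>e\<^sub>i\<close> and \<open>e\<^sub>j\<close>, so the new step leaves them alone.\<close>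
    have old: "S' $$ (r, l) = S $$ (r, l)" if "r < m" "r \<notin> T" "l < m" for r l
    proof (cases "l \<in> {i, j}")
      case True
      have "r \<notin> {i, j}" using that ij by auto
      then have "S' $$ (l, r) = 0"
        using True entries(1,2)[OF that(1)] by auto
      then show ?thesis
        using True S'_skew'[of r l] block[of r l] that ij by auto
    next
      case False
      have "r \<notin> {i, j}" using that ij by auto
      then show ?thesis
        using False entries(3)[OF that(1,3)] block[of r i] block[of r j] that ij by auto
    qed
    have "card T' < card T"
      using ij T_sub finite_subset[OF T_sub] unfolding T'_def by (intro psubset_card_mono) auto
    then have "\<exists>c \<in> Iwahori m. transpose_mat c * S' * c \<in> SkewAPM m"
    proof (rule less.hyps[OF _ S'_GL S'_skew])
      show "T' \<subseteq> {..<m}" using T_sub by (auto simp: T'_def)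
    next
      fix r assume r: "r < m" "r \<notin> T'"
      then consider "r = i" | "r = j" | "r \<notin> T" by (auto simp: T'_def)
      then show "\<exists>!l. l < m \<and> S' $$ (r, l) \<noteq> 0"
      proof cases
        case 1
        then show ?thesis using entries(1) ij by (auto intro!: ex1I[of _ j] split: if_splits)
      next
        case 2
        then show ?thesis using entries(2) im by (auto intro!: ex1I[of _ i] split: if_splits)
      next
        case 3
        have "(l < m \<and> S' $$ (r, l) \<noteq> 0) = (l < m \<and> S $$ (r, l) \<noteq> 0)" for l
          using old[OF r(1) 3] by auto
        then show ?thesis using uniq[OF r(1) 3] by simp
      qed
    next
      fix r l assume rl: "r < m" "r \<notin> T'" "l \<in> T'"
      then have "l < m" "l \<noteq> i" "l \<noteq> j" "l \<in> T" using T_sub by (auto simp: T'_def)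
      then show "S' $$ (r, l) = 0"
        using entries(1,2)[of l] old[of r l] block[of r l] rl by (auto simp: T'_def)
    next
      fix r l assume rl: "r < l" "l < m" "r \<notin> T'" "S' $$ (r, l) \<noteq> 0"
      then consider "r = i" | "r = j" | "r \<notin> T" by (auto simp: T'_def)
      then show "\<exists>a. S' $$ (r, l) = fls_X powi a"
      proof cases
        case 1
        then show ?thesis using entries(1)[OF rl(2)] rl(4) by (metis (full_types))
      next
        case 2
        then show ?thesis using entries(2)[OF rl(2)] rl ij by (auto split: if_splits)
      next
        case 3
        then show ?thesis using old[of r l] pow[of r l] rl by auto
      qed
    qed
    then obtain c where c: "c \<in> Iwahori m" "transpose_mat c * S' * c \<in> SkewAPM m" ..
    have "c \<in> carrier_mat m m"
      using c(1) Iwahori_subset_GL GL_carrier by blast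
    then have "transpose_mat (?b * c) * S * (?b * c) \<in> SkewAPM m"
      using c(2) S congruence_mult[OF S, of ?b c] by (simp add: S'_def)
    then show ?thesis
      using Iwahori_mult[OF b c(1)] by blast
  qed
qed


section \<open>Uniqueness of the monomial form\<close>

text \<open>The positions of the non-zero entries of a skew-symmetric monomial matrix are described by an
  involution.\<close>

lemma SkewAPM_partner:
  assumes "w \<in> SkewAPM m"
  obtains \<sigma> where
    "\<And>i. i < m \<Longrightarrow> \<sigma> i < m"
    "\<And>i. i < m \<Longrightarrow> \<sigma> (\<sigma> i) = i"
    "\<And>i j. i < m \<Longrightarrow> j < m \<Longrightarrow> w $$ (i, j) \<noteq> 0 \<longleftrightarrow> j = \<sigma> i"
proof -
  have w: "w \<in> carrier_mat m m" "transpose_mat w = - w"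
    using assms by (auto simp: SkewAPM_def)
  have ex1: "\<forall>i<m. \<exists>!j. j < m \<and> w $$ (i, j) \<noteq> 0"
    using assms w(1) by (simp add: SkewAPM_def monomial_mat_def)
  define \<sigma> where "\<sigma> i = (THE j. j < m \<and> w $$ (i, j) \<noteq> 0)" for i
  have \<sigma>: "\<sigma> i < m" "w $$ (i, \<sigma> i) \<noteq> 0" if "i < m" for i
    using theI'[OF ex1[rule_format, OF that]] by (simp_all add: \<sigma>_def)
  have iff: "w $$ (i, j) \<noteq> 0 \<longleftrightarrow> j = \<sigma> i" if "i < m" "j < m" for i j
    using ex1 \<sigma> that by blast
  have "\<sigma> (\<sigma> i) = i" if "i < m" for i
    using iff[of "\<sigma> i" i] iff[of i "\<sigma> i"] \<sigma>(1)[OF that] that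
      skew_entry[OF w(2,1), of i "\<sigma> i"] by simp
  with \<sigma>(1) iff show ?thesis using that by blast
qed

lemma SkewAPM_entry:
  assumes "w \<in> SkewAPM m" "i < j" "j < m" "w $$ (i, j) \<noteq> 0"
  obtains a where "w $$ (i, j) = fls_X powi a"
  using assms unfolding SkewAPM_def by blast

lemma SkewAPM_subset_GL: "SkewAPM m \<subseteq> (GL m :: 'a::field fls mat set)"
proof
  fix w :: "'a fls mat" assume "w \<in> SkewAPM m"
  then obtain \<sigma> where \<sigma>: "\<And>i. i < m \<Longrightarrow> \<sigma> i < m" "\<And>i. i < m \<Longrightarrow> \<sigma> (\<sigma> i) = i"
    "\<And>i j. i < m \<Longrightarrow> j < m \<Longrightarrow> w $$ (i, j) \<noteq> 0 \<longleftrightarrow> j = \<sigma> i"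
    using SkewAPM_partner by blast
  have w: "w \<in> carrier_mat m m"
    using \<open>w \<in> SkewAPM m\<close> by (simp add: SkewAPM_def)
  define v where "v = mat m m (\<lambda>(i, j). inverse (w $$ (j, i)))"
  have v: "v \<in> carrier_mat m m" by (simp add: v_def)
  have "w * v = 1\<^sub>m m"
  proof (rule eq_matI)
    fix i j assume "i < dim_row (1\<^sub>m m)" "j < dim_col (1\<^sub>m m)"
    then have ij: "i < m" "j < m" by simp_all
    have inj: "\<sigma> j = \<sigma> i \<longleftrightarrow> i = j" using \<sigma>(2) ij by metis
    have "(w * v) $$ (i, j) = (\<Sum>k = 0..<m. w $$ (i, k) * inverse (w $$ (j, k)))"
      using w v ij by (auto simp: scalar_prod_def v_def intro!: sum.cong)
    also have "\<dots> = (\<Sum>k = 0..<m. if k = \<sigma> i then of_bool (i = j) else 0)"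
    proof (rule sum.cong[OF refl])
      fix k assume "k \<in> {0..<m}"
      then show "w $$ (i, k) * inverse (w $$ (j, k)) = (if k = \<sigma> i then of_bool (i = j) else 0)"
        using \<sigma>(3)[of i k] \<sigma>(3)[of j k] ij inj by auto
    qed
    also have "\<dots> = 1\<^sub>m m $$ (i, j)"
      using ij \<sigma>(1) by simp
    finally show "(w * v) $$ (i, j) = 1\<^sub>m m $$ (i, j)" .
  qed (use w v in auto)
  with mat_mult_left_right_inverse[OF w v] w v show "w \<in> GL m"
    by (auto simp: GL_iff)
qed

text \<open>Write \<open>\<sigma>\<close> and \<open>\<tau>\<close> for the involutions of \<open>w\<close> and \<open>w'\<close>, and \<open>a\<^sub>i\<close> and \<open>a'\<^sub>i\<close> for the valuations of
  their non-zero entries in row \<open>i\<close>. With \<open>c\<close> the inverse of \<open>b\<close>, the equation \<open>c\<^sup>T w' = w b\<close> has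
  monomial factors on either side, so each of its entries is an identity between single products.
  Comparing valuations where \<open>b\<close> or \<open>c\<close> contributes a diagonal entry gives
  \<open>a'\<^bsub>\<pi> i\<^esub> + [i < \<pi> i] \<le> a\<^sub>i\<close> with \<open>\<pi> = \<tau> \<circ> \<sigma>\<close>, and \<open>a\<^sub>i \<le> a'\<^sub>i\<close>. Summing over the permutation \<open>\<pi>\<close> turns
  all of these into equalities; so \<open>\<pi> i \<le> i\<close> for all \<open>i\<close>, which makes \<open>\<pi>\<close> the identity.\<close>

lemma SkewAPM_unique:
  fixes w w' :: "'a::field fls mat"
  assumes two: "(2 :: 'a fls) \<noteq> 0" and w: "w \<in> SkewAPM m" and w': "w' \<in> SkewAPM m"
    and b: "b \<in> Iwahori m" and eq: "transpose_mat b * w * b = w'"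
  shows "w = w'"
proof -
  obtain c where c: "c \<in> Iwahori m" "b * c = 1\<^sub>m m"
    using Iwahori_inverse[OF b] by metis
  have carr: "w \<in> carrier_mat m m" "w' \<in> carrier_mat m m" "b \<in> carrier_mat m m" "c \<in> carrier_mat m m"
    using w w' b c(1) by (auto simp: SkewAPM_def Iwahori_iff)
  have skew: "transpose_mat w = - w" "transpose_mat w' = - w'"
    using w w' by (auto simp: SkewAPM_def)
  have "transpose_mat c * w' = transpose_mat (b * c) * (w * b)"
    using carr by (simp add: transpose_mult[of _ m m _ m] assoc_mult_mat[of _ m m _ m _ m] flip: eq)
  then have cw: "transpose_mat c * w' = w * b"
    using c(2) carr by simp
  obtain \<sigma> where \<sigma>: "\<And>i. i < m \<Longrightarrow> \<sigma> i < m" "\<And>i. i < m \<Longrightarrow> \<sigma> (\<sigma> i) = i"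
    "\<And>i j. i < m \<Longrightarrow> j < m \<Longrightarrow> w $$ (i, j) \<noteq> 0 \<longleftrightarrow> j = \<sigma> i"
    using SkewAPM_partner[OF w] by blast
  obtain \<tau> where \<tau>: "\<And>i. i < m \<Longrightarrow> \<tau> i < m" "\<And>i. i < m \<Longrightarrow> \<tau> (\<tau> i) = i"
    "\<And>i j. i < m \<Longrightarrow> j < m \<Longrightarrow> w' $$ (i, j) \<noteq> 0 \<longleftrightarrow> j = \<tau> i"
    using SkewAPM_partner[OF w'] by blast
  have key: "c $$ (\<tau> l, i) * w' $$ (\<tau> l, l) = w $$ (i, \<sigma> i) * b $$ (\<sigma> i, l)" if "i < m" "l < m" for i l
  proof -
    have "(transpose_mat c * w') $$ (i, l) = (\<Sum>k = 0..<m. c $$ (k, i) * w' $$ (k, l))"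
      using carr that by (auto simp: scalar_prod_def intro!: sum.cong)
    also have "\<dots> = (\<Sum>k = 0..<m. if k = \<tau> l then c $$ (\<tau> l, i) * w' $$ (\<tau> l, l) else 0)"
    proof (rule sum.cong[OF refl])
      fix k assume "k \<in> {0..<m}"
      then show "c $$ (k, i) * w' $$ (k, l) = (if k = \<tau> l then c $$ (\<tau> l, i) * w' $$ (\<tau> l, l) else 0)"
        using \<tau>(3)[of k l] \<tau>(2)[of k] that by auto
    qed
    also have "\<dots> = c $$ (\<tau> l, i) * w' $$ (\<tau> l, l)"
      using \<tau>(1) that by simp
    finally have l: "(transpose_mat c * w') $$ (i, l) = c $$ (\<tau> l, i) * w' $$ (\<tau> l, l)" .
    have "(w * b) $$ (i, l) = (\<Sum>k = 0..<m. w $$ (i, k) * b $$ (k, l))"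
      using carr that by (auto simp: scalar_prod_def intro!: sum.cong)
    also have "\<dots> = (\<Sum>k = 0..<m. if k = \<sigma> i then w $$ (i, \<sigma> i) * b $$ (\<sigma> i, l) else 0)"
    proof (rule sum.cong[OF refl])
      fix k assume "k \<in> {0..<m}"
      then show "w $$ (i, k) * b $$ (k, l) = (if k = \<sigma> i then w $$ (i, \<sigma> i) * b $$ (\<sigma> i, l) else 0)"
        using \<sigma>(3)[of i k] that by auto
    qed
    also have "\<dots> = w $$ (i, \<sigma> i) * b $$ (\<sigma> i, l)"
      using \<sigma>(1) that by simp
    finally show ?thesis using l cw by simp
  qed
  define a a' where "a i = fls_subdegree (w $$ (i, \<sigma> i))" and "a' i = fls_subdegree (w' $$ (i, \<tau> i))" for i
  have nz: "w $$ (i, \<sigma> i) \<noteq> 0" "w' $$ (i, \<tau> i) \<noteq> 0" if "i < m" for i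
    using \<sigma> \<tau> that by auto
  have val: "x $$ (k, l) \<noteq> 0 \<Longrightarrow> of_bool (l < k) \<le> fls_subdegree (x $$ (k, l))"
    "x $$ (k, k) \<noteq> 0" "fls_subdegree (x $$ (k, k)) = 0"
    if "x \<in> Iwahori m" "k < m" "l < m" for x :: "'a fls mat" and k l
    using that by (auto simp: Iwahori_iff)
  define \<pi> where "\<pi> i = \<tau> (\<sigma> i)" for i
  have \<pi>: "bij_betw \<pi> {..<m} {..<m}"
    by (rule bij_betw_byWitness[of _ "\<lambda>i. \<sigma> (\<tau> i)"]) (auto simp: \<pi>_def \<sigma> \<tau>)
  have le1: "a' (\<pi> i) + of_bool (i < \<pi> i) \<le> a i" if i: "i < m" for i
  proof -
    have \<pi>i: "\<pi> i < m" "\<tau> (\<pi> i) = \<sigma> i" using i by (simp_all add: \<pi>_def \<sigma> \<tau>)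
    have e: "c $$ (\<pi> i, i) * w' $$ (\<pi> i, \<sigma> i) = w $$ (i, \<sigma> i) * b $$ (\<sigma> i, \<sigma> i)"
      using key[OF i \<sigma>(1)[OF i]] by (simp add: \<pi>_def)
    have bnz: "b $$ (\<sigma> i, \<sigma> i) \<noteq> 0" "fls_subdegree (b $$ (\<sigma> i, \<sigma> i)) = 0"
      using val[OF b] \<sigma>(1)[OF i] by blast+
    then have cnz: "c $$ (\<pi> i, i) \<noteq> 0"
      using e nz(1)[OF i] by auto
    have "fls_subdegree (c $$ (\<pi> i, i)) + a' (\<pi> i) = a i"
      using arg_cong[OF e, of fls_subdegree] bnz cnz nz(1)[OF i] nz(2)[OF \<pi>i(1)]
      by (simp add: a_def a'_def \<pi>i(2))
    then show ?thesis
      using val(1)[OF c(1) \<pi>i(1) i cnz] by simp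
  qed
  have le2: "a i \<le> a' i" if i: "i < m" for i
  proof -
    have e: "c $$ (i, i) * w' $$ (i, \<tau> i) = w $$ (i, \<sigma> i) * b $$ (\<sigma> i, \<tau> i)"
      using key[OF i \<tau>(1)[OF i]] i by (simp add: \<tau>)
    have cnz: "c $$ (i, i) \<noteq> 0" "fls_subdegree (c $$ (i, i)) = 0"
      using val[OF c(1)] i by blast+
    then have bnz: "b $$ (\<sigma> i, \<tau> i) \<noteq> 0"
      using e nz(2)[OF i] by auto
    have "a' i = a i + fls_subdegree (b $$ (\<sigma> i, \<tau> i))"
      using arg_cong[OF e, of fls_subdegree] bnz cnz nz[OF i]
      by (simp add: a_def a'_def)
    moreover have "0 \<le> fls_subdegree (b $$ (\<sigma> i, \<tau> i))"
      using val(1)[OF b \<sigma>(1)[OF i] \<tau>(1)[OF i] bnz] by (rule order_trans[rotated]) simp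
    ultimately show ?thesis by simp
  qed
  \<comment> \<open>Since \<open>\<pi>\<close> is a permutation, the non-negative differences below sum to zero.\<close>
  have "(\<Sum>i<m. a' (\<pi> i)) = (\<Sum>i<m. a' i)"
    using sum.reindex_bij_betw[OF \<pi>] .
  then have "(\<Sum>i<m. (a i - a' (\<pi> i)) + (a' i - a i)) = 0"
    by (simp add: sum.distrib sum_subtractf)
  moreover have "0 \<le> (a i - a' (\<pi> i)) + (a' i - a i)" if "i < m" for i
    using le1[OF that] le2[OF that] by (simp add: of_bool_def split: if_splits)
  ultimately have zero: "(a i - a' (\<pi> i)) + (a' i - a i) = 0" if "i < m" for i
    using sum_nonneg_eq_0_iff[of "{..<m}" "\<lambda>i. (a i - a' (\<pi> i)) + (a' i - a i)"] that by auto
  have aa': "a i = a' i" and \<pi>_le: "\<pi> i \<le> i" if "i < m" for i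
    using zero[OF that] le1[OF that] le2[OF that] by (auto split: if_splits simp: of_bool_def)
  have "(\<Sum>i<m. \<pi> i) = (\<Sum>i<m. i)"
    using sum.reindex_bij_betw[OF \<pi>, of "\<lambda>i. i"] .
  then have "(\<Sum>i<m. i - \<pi> i) = 0"
    using \<pi>_le by (subst sum_subtractf_nat) auto
  then have "\<pi> i = i" if "i < m" for i
    using that \<pi>_le[OF that] by (auto intro: le_antisym)
  then have \<sigma>\<tau>: "\<sigma> i = \<tau> i" if "i < m" for i
    using that \<tau>(2)[of "\<sigma> i"] \<sigma>(1) by (simp add: \<pi>_def)
  have upper: "w $$ (i, j) = w' $$ (i, j)" if ij: "i < j" "j < m" for i j
  proof (cases "j = \<sigma> i")
    case True
    have "i < m" using ij by simp
    moreover from this obtain k k' where "w $$ (i, j) = fls_X powi k" "w' $$ (i, j) = fls_X powi k'"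
      using SkewAPM_entry[OF w ij] SkewAPM_entry[OF w' ij] nz[of i] True \<sigma>\<tau>[of i] by metis
    ultimately show ?thesis
      using aa'[of i] True \<sigma>\<tau>[of i] by (simp add: a_def a'_def)
  next
    case False
    then show ?thesis
      using \<sigma>(3)[of i j] \<tau>(3)[of i j] \<sigma>\<tau>[of i] that by simp
  qed
  show ?thesis
  proof (rule eq_matI)
    fix i j assume "i < dim_row w'" "j < dim_col w'"
    then have ij: "i < m" "j < m" using carr by auto
    then show "w $$ (i, j) = w' $$ (i, j)"
      using upper[of i j] upper[of j i] skew_entry[OF skew(1) carr(1) ij] skew_entry[OF skew(2) carr(2) ij]
        skew_diag_zero[OF skew(1) carr(1) _ two] skew_diag_zero[OF skew(2) carr(2) _ two]
      by (cases i j rule: linorder_cases) auto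
  qed (use carr in auto)
qed

section \<open>The standard symplectic form\<close>

lemma J_mat_carrier [simp]: "J_mat n \<in> carrier_mat (2 * n) (2 * n)"
  unfolding J_mat_def mult_2 by (rule four_block_carrier_mat) simp_all

lemma J_mat_entry:
  assumes "r < 2 * n" "k < 2 * n"
  shows "J_mat n $$ (r, k) = (if k = r + n then 1 else if r = k + n then - 1 else 0 :: 'a::comm_ring_1)"
  using assms by (auto simp: J_mat_def)

lemma J_mat_skew: "transpose_mat (J_mat n) = - (J_mat n :: 'a::comm_ring_1 mat)"
  by (rule eq_matI) (auto simp: J_mat_entry simp: carrier_matD[OF J_mat_carrier])

lemma J_mat_GL: "J_mat n \<in> GL (2 * n)"
proof -
  have "J_mat n * J_mat n = (- 1\<^sub>m (2 * n) :: 'a mat)"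
  proof (rule eq_matI)
    fix i j assume "i < dim_row (- 1\<^sub>m (2 * n) :: 'a mat)" "j < dim_col (- 1\<^sub>m (2 * n) :: 'a mat)"
    then have ij: "i < 2 * n" "j < 2 * n" by simp_all
    define p where "p = (if i < n then i + n else i - n)"
    have p: "p < 2 * n" using ij by (auto simp: p_def)
    have "(J_mat n * J_mat n) $$ (i, j) = (\<Sum>k = 0..<2 * n. J_mat n $$ (i, k) * J_mat n $$ (k, j) :: 'a)"
      using ij by (auto simp: scalar_prod_def carrier_matD[OF J_mat_carrier] intro!: sum.cong)
    also have "\<dots> = (\<Sum>k = 0..<2 * n. if k = p then - of_bool (i = j) else 0)"
      using ij by (intro sum.cong) (auto simp: J_mat_entry p_def)
    also have "\<dots> = (- 1\<^sub>m (2 * n)) $$ (i, j)"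
      using p ij by simp
    finally show "(J_mat n * J_mat n) $$ (i, j) = (- 1\<^sub>m (2 * n) :: 'a mat) $$ (i, j)" .
  qed (auto simp: carrier_matD[OF J_mat_carrier])
  then have "J_mat n * - J_mat n = (1\<^sub>m (2 * n) :: 'a mat)" "- J_mat n * J_mat n = (1\<^sub>m (2 * n) :: 'a mat)"
    by (simp_all add: uminus_mult_left_mat uminus_mult_right_mat carrier_matD[OF J_mat_carrier])
  then show ?thesis
    unfolding GL_iff by (intro conjI bexI[of _ "- J_mat n"]) simp_all
qed

text \<open>An explicit symplectic basis: let \<open>e\<close> enumerate the \<open>n\<close> indices \<open>i\<close> with \<open>i < \<sigma> i\<close>, where \<open>\<sigma>\<close> is the
  involution of \<open>w\<close>. The matrix \<open>g\<close> whose row \<open>k\<close> is the unit vector at \<open>e k\<close> and whose row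
  \<open>n + k\<close> is row \<open>e k\<close> of \<open>w\<close> satisfies \<open>g\<^sup>T J g = w\<close>.\<close>

lemma SkewAPM_congruent_J_mat:
  fixes w :: "'a::field fls mat"
  assumes two: "(2 :: 'a fls) \<noteq> 0" and w: "w \<in> SkewAPM (2 * n)"
  obtains g where "g \<in> GL (2 * n)" "transpose_mat g * J_mat n * g = w"
proof -
  let ?m = "2 * n"
  have carr: "w \<in> carrier_mat ?m ?m" and skew: "transpose_mat w = - w"
    using w by (auto simp: SkewAPM_def)
  obtain \<sigma> where \<sigma>: "\<And>i. i < ?m \<Longrightarrow> \<sigma> i < ?m" "\<And>i. i < ?m \<Longrightarrow> \<sigma> (\<sigma> i) = i"
    "\<And>i j. i < ?m \<Longrightarrow> j < ?m \<Longrightarrow> w $$ (i, j) \<noteq> 0 \<longleftrightarrow> j = \<sigma> i"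
    using SkewAPM_partner[OF w] by blast
  have nofix: "\<sigma> i \<noteq> i" if "i < ?m" for i
    using \<sigma>(3)[OF that that] skew_diag_zero[OF skew carr that two] by auto
  define L where "L = {i. i < ?m \<and> i < \<sigma> i}"
  have fin: "finite L" by (simp add: L_def)
  have "bij_betw \<sigma> L ({..<?m} - L)"
    by (rule bij_betw_byWitness[of _ \<sigma>]) (use \<sigma> nofix in \<open>fastforce simp: L_def not_less le_less\<close>)+
  then have "card L = card ({..<?m} - L)" by (rule bij_betw_same_card)
  also have "\<dots> = ?m - card L"
    using fin by (subst card_Diff_subset) (auto simp: L_def)
  finally have "card L = n" by linarith
  then obtain e where e: "bij_betw e {0..<n} L"
    using ex_bij_betw_nat_finite[OF fin] by auto
  have eL: "e k \<in> L" "e k < ?m" if "k < n" for k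
    using bij_betwE[OF e] that by (auto simp: L_def)
  define g where "g = mat ?m ?m (\<lambda>(k, j). if k < n then of_bool (j = e k) else w $$ (e (k - n), j))"
  have g: "g \<in> carrier_mat ?m ?m" by (simp add: g_def)
  have g_top: "g $$ (k, j) = of_bool (j = e k)" and g_bottom: "g $$ (k + n, j) = w $$ (e k, j)"
    if "k < n" "j < ?m" for k j
    using that by (simp_all add: g_def)
  have Jg: "(J_mat n * g) $$ (k, j) = (if k < n then g $$ (k + n, j) else - g $$ (k - n, j))"
    if "k < ?m" "j < ?m" for k j
  proof -
    define p where "p = (if k < n then k + n else k - n)"
    have p: "p < ?m" using that by (auto simp: p_def)
    have "(J_mat n * g) $$ (k, j) = (\<Sum>q = 0..<?m. J_mat n $$ (k, q) * g $$ (q, j))"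
      using that g by (auto simp: scalar_prod_def carrier_matD[OF J_mat_carrier] intro!: sum.cong)
    also have "\<dots> = (\<Sum>q = 0..<?m. if q = p then (if k < n then g $$ (p, j) else - g $$ (p, j)) else 0)"
      using that by (intro sum.cong) (auto simp: J_mat_entry p_def)
    finally show ?thesis using p by (simp add: p_def)
  qed
  have "transpose_mat g * J_mat n * g = w"
  proof (rule eq_matI)
    fix i j assume "i < dim_row w" "j < dim_col w"
    then have ij: "i < ?m" "j < ?m" using carr by auto
    have sum_e: "(\<Sum>k = 0..<n. of_bool (x = e k) * f (e k)) = of_bool (x \<in> L) * f x"
      for x and f :: "nat \<Rightarrow> 'a fls"
    proof -
      have "(\<Sum>k = 0..<n. of_bool (x = e k) * f (e k)) = (\<Sum>y\<in>L. of_bool (x = y) * f y)"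
        by (rule sum.reindex_bij_betw[OF e])
      also have "\<dots> = (\<Sum>y\<in>L. if x = y then f y else 0)"
        by (rule sum.cong) auto
      finally show ?thesis using fin by simp
    qed
    have "(transpose_mat g * J_mat n * g) $$ (i, j) = (transpose_mat g * (J_mat n * g)) $$ (i, j)"
      using g by (simp add: assoc_mult_mat[of _ ?m ?m _ ?m _ ?m])
    also have "\<dots> = (\<Sum>k = 0..<n + n. g $$ (k, i) * (J_mat n * g) $$ (k, j))"
      using g ij by (auto simp: scalar_prod_def carrier_matD[OF J_mat_carrier] mult_2 intro!: sum.cong)
    also have "\<dots> = (\<Sum>k = 0..<n. g $$ (k, i) * (J_mat n * g) $$ (k, j))
        + (\<Sum>k = 0..<n. g $$ (k + n, i) * (J_mat n * g) $$ (k + n, j))"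
      by (simp add: sum.shift_bounds_nat_ivl[of _ 0 n n, simplified]
          flip: sum.atLeastLessThan_concat[of 0 n "n + n"])
    also have "(\<Sum>k = 0..<n. g $$ (k, i) * (J_mat n * g) $$ (k, j))
        = (\<Sum>k = 0..<n. of_bool (i = e k) * w $$ (e k, j))"
      using ij by (intro sum.cong) (auto simp: Jg g_top g_bottom)
    also have "\<dots> = of_bool (i \<in> L) * w $$ (i, j)"
      by (rule sum_e)
    also have "(\<Sum>k = 0..<n. g $$ (k + n, i) * (J_mat n * g) $$ (k + n, j))
        = (\<Sum>k = 0..<n. of_bool (j = e k) * - w $$ (e k, i))"
      using ij by (intro sum.cong) (auto simp: Jg g_top g_bottom)
    also have "\<dots> = of_bool (j \<in> L) * - w $$ (j, i)"
      by (rule sum_e)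
    also have "\<dots> = of_bool (j \<in> L) * w $$ (i, j)"
      using skew_entry[OF skew carr ij] by simp
    \<comment> \<open>Of the two indices of a non-zero entry of \<open>w\<close> exactly one lies in \<open>L\<close>.\<close>
    also have "of_bool (i \<in> L) * w $$ (i, j) + of_bool (j \<in> L) * w $$ (i, j) = w $$ (i, j)"
    proof (cases "j = \<sigma> i")
      case True
      then have "i \<in> L \<longleftrightarrow> j \<notin> L"
        using \<sigma>(2)[of i] nofix[of i] ij by (auto simp: L_def)
      then show ?thesis by auto
    next
      case False
      then show ?thesis using \<sigma>(3)[OF ij] by simp
    qed
    finally show "(transpose_mat g * J_mat n * g) $$ (i, j) = w $$ (i, j)" .
  qed (use g carr in auto)
  moreover have "g \<in> GL ?m"
  proof -
    have "det g dvd det w"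
      using det_mult[of "transpose_mat g * J_mat n" ?m g] g calculation by (metis J_mat_carrier dvd_triv_right mult_carrier_mat transpose_carrier_mat)
    moreover have "det w dvd 1"
      using w SkewAPM_subset_GL GL_iff_det_unit by blast
    ultimately show ?thesis
      using g by (auto simp: GL_iff_det_unit intro: dvd_trans)
  qed
  ultimately show ?thesis using that by blast
qed

text \<open>Each non-empty fibre of \<open>g \<mapsto> g\<^sup>T J g\<close> on the general linear group is a single coset \<open>K g\<close> of the
  symplectic group \<open>K\<close>, since \<open>h\<close> times the inverse of \<open>g\<close> preserves \<open>J\<close>.\<close>

lemma GL_congruent_imp_Sp:
  fixes g h :: "'a::field mat"
  assumes g: "g \<in> GL (2 * n)" and h: "h \<in> GL (2 * n)"
    and eq: "transpose_mat h * J_mat n * h = transpose_mat g * J_mat n * g"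
  obtains k where "k \<in> Sp n" "h = k * g"
proof -
  let ?m = "2 * n"
  obtain g' where g': "g' \<in> carrier_mat ?m ?m" "g * g' = 1\<^sub>m ?m" "g' * g = 1\<^sub>m ?m"
    using g by (auto simp: GL_iff)
  have carr: "g \<in> carrier_mat ?m ?m" "h \<in> carrier_mat ?m ?m"
    using g h by (auto dest: GL_carrier)
  have g'_GL: "g' \<in> GL ?m" using g' carr by (auto simp: GL_iff)
  have "transpose_mat (h * g') * J_mat n * (h * g') = transpose_mat g' * (transpose_mat h * J_mat n * h) * g'"
    using carr g' by (simp add: congruence_mult[of _ ?m])
  also have "\<dots> = transpose_mat (g * g') * J_mat n * (g * g')"
    using carr g'(1) by (simp only: eq congruence_mult[of _ ?m, OF J_mat_carrier])
  also have "\<dots> = J_mat n"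
    by (simp add: g'(2) left_mult_one_mat[OF J_mat_carrier] right_mult_one_mat[OF J_mat_carrier])
  finally have "h * g' \<in> Sp n"
    using GL_mult[OF h g'_GL] by (simp add: Sp_def)
  moreover have "h = h * g' * g"
    using carr g' by (simp add: assoc_mult_mat[of _ ?m ?m _ ?m _ ?m])
  ultimately show ?thesis using that by blast
qed

section \<open>Symplectic-Iwahori double cosets\<close>

theorem theorem1p9:
  fixes n :: nat
  assumes "n \<ge> 1"
    and "quadratically_closed TYPE('a::field)"
  shows "(\<forall>D \<in> double_cosets (Sp n) (GL (2 * n)) (Iwahori (2 * n) :: 'a fls mat set).
            \<exists>!w. w \<in> SkewAPM (2 * n) \<and> (\<exists>g \<in> D. transpose_mat g * J_mat n * g = w))
       \<and> (\<forall>w \<in> (SkewAPM (2 * n) :: 'a fls mat set).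
            {g \<in> GL (2 * n). transpose_mat g * J_mat n * g = w} \<noteq> {} \<and>
            (\<exists>D \<in> double_cosets (Sp n) (GL (2 * n)) (Iwahori (2 * n)).
               {g \<in> GL (2 * n). transpose_mat g * J_mat n * g = w} \<subseteq> D))"
proof (intro conjI ballI)
  note two = quadratically_closed_two_neq_0[OF assms(2)]
  fix D assume "D \<in> double_cosets (Sp n) (GL (2 * n)) (Iwahori (2 * n) :: 'a fls mat set)"
  then obtain g where g: "g \<in> GL (2 * n)" and D: "D = {k * g * b | k b. k \<in> Sp n \<and> b \<in> Iwahori (2 * n)}"
    by (auto simp: double_cosets_def)
  have g_carr: "g \<in> carrier_mat (2 * n) (2 * n)" using g GL_carrier by blast
  define S where "S = transpose_mat g * J_mat n * g"
  have S_GL: "S \<in> GL (2 * n)"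
    unfolding S_def by (intro GL_mult GL_transpose g J_mat_GL)
  then have S_carr: "S \<in> carrier_mat (2 * n) (2 * n)" by (rule GL_carrier)
  have S_skew: "transpose_mat S = - S"
    unfolding S_def by (rule skew_congruence[OF J_mat_skew J_mat_carrier g_carr])
  have value_on_D: "transpose_mat (k * g * b) * J_mat n * (k * g * b) = transpose_mat b * S * b"
    if "k \<in> Sp n" "b \<in> Iwahori (2 * n)" for k b
  proof -
    have k: "k \<in> carrier_mat (2 * n) (2 * n)" "transpose_mat k * J_mat n * k = J_mat n"
      using that(1) by (auto simp: Sp_def dest: GL_carrier)
    have b: "b \<in> carrier_mat (2 * n) (2 * n)" using that(2) by (simp add: Iwahori_iff)
    show ?thesis
      using congruence_mult[OF J_mat_carrier mult_carrier_mat[OF k(1) g_carr] b]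
        congruence_mult[OF J_mat_carrier k(1) g_carr] k(2) by (simp add: S_def)
  qed
  obtain b where b: "b \<in> Iwahori (2 * n)" "transpose_mat b * S * b \<in> SkewAPM (2 * n)"
    using reduce_to_SkewAPM[OF two S_GL S_skew, of "{..<2 * n}"] by auto
  have one: "1\<^sub>m (2 * n) \<in> (Sp n :: 'a fls mat set)"
    by (simp add: Sp_def GL_one left_mult_one_mat[OF J_mat_carrier] right_mult_one_mat[OF J_mat_carrier])
  show "\<exists>!w. w \<in> SkewAPM (2 * n) \<and> (\<exists>g \<in> D. transpose_mat g * J_mat n * g = w)"
  proof (rule ex1I[of _ "transpose_mat b * S * b"])
    show "transpose_mat b * S * b \<in> SkewAPM (2 * n) \<and> (\<exists>g \<in> D. transpose_mat g * J_mat n * g = transpose_mat b * S * b)"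
      using b value_on_D[OF one b(1)] one unfolding D by blast
  next
    fix w assume w: "w \<in> SkewAPM (2 * n) \<and> (\<exists>g \<in> D. transpose_mat g * J_mat n * g = w)"
    then obtain c where c: "c \<in> Iwahori (2 * n)" "w = transpose_mat c * S * c"
      unfolding D using value_on_D by blast
    obtain b' where b': "b' \<in> Iwahori (2 * n)" "b * b' = 1\<^sub>m (2 * n)"
      using Iwahori_inverse[OF b(1)] by metis
    have carr: "b \<in> carrier_mat (2 * n) (2 * n)" "b' \<in> carrier_mat (2 * n) (2 * n)" "c \<in> carrier_mat (2 * n) (2 * n)"
      using b b' c by (auto simp: Iwahori_iff)
    have "b * (b' * c) = c"
      using carr b'(2) by (simp flip: assoc_mult_mat[of _ "2 * n" "2 * n" _ "2 * n" _ "2 * n"])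
    then have e: "transpose_mat (b' * c) * (transpose_mat b * S * b) * (b' * c) = w"
      using congruence_mult[OF S_carr carr(1), of "b' * c"] carr c(2) by simp
    then show "w = transpose_mat b * S * b"
      using SkewAPM_unique[OF two b(2) _ Iwahori_mult[OF b'(1) c(1)] e] w by simp
  qed
next
  note two = quadratically_closed_two_neq_0[OF assms(2)]
  fix w :: "'a fls mat" assume "w \<in> SkewAPM (2 * n)"
  then obtain g where g: "g \<in> GL (2 * n)" "transpose_mat g * J_mat n * g = w"
    using SkewAPM_congruent_J_mat[OF two] by blast
  then show "{g \<in> GL (2 * n). transpose_mat g * J_mat n * g = w} \<noteq> {}" by blast
  let ?D = "{k * g * b | k b. k \<in> Sp n \<and> b \<in> Iwahori (2 * n)}"
  show "\<exists>D \<in> double_cosets (Sp n) (GL (2 * n)) (Iwahori (2 * n)).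
          {g \<in> GL (2 * n). transpose_mat g * J_mat n * g = w} \<subseteq> D"
  proof (intro bexI subsetI)
    show "?D \<in> double_cosets (Sp n) (GL (2 * n)) (Iwahori (2 * n))"
      using g(1) by (auto simp: double_cosets_def)
    fix h assume "h \<in> {g \<in> GL (2 * n). transpose_mat g * J_mat n * g = w}"
    then have h: "h \<in> GL (2 * n)" "transpose_mat h * J_mat n * h = transpose_mat g * J_mat n * g"
      using g by auto
    obtain k where k: "k \<in> Sp n" "h = k * g"
      using GL_congruent_imp_Sp[OF g(1) h] .
    have "h = k * g * 1\<^sub>m (2 * n)"
      using GL_carrier[OF h(1)] unfolding k(2) by (rule right_mult_one_mat[symmetric])
    then show "h \<in> ?D"
      using k(1) Iwahori_one by blast
  qed
qed

end
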